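(* Let $G=(V,E)$ be a connected block graph and let $X$ be the set of its articulation vertices. Then $V\setminus X$ is a mutual-visibility set of $G$ and $\mu(G)=|V\setminus X|$.
   Context: Graphs are finite, simple, loopless, undirected and unweighted, with nonempty vertex set. For a graph $G=(V,E)$ and $P\subseteq V$, two vertices $u,v\in P$ are mutually visible if there is a shortest $(u,v)$-path in $G$ containing no vertex of $P$ other than $u$ and $v$ (vertices in different connected components are not mutually visible). $P$ is a mutual-visibility set of $G$ if its vertices are pairwise mutually visible. The mutual-visibility number $\mu(G)$ is the maximum cardinality of a mutual-visibility set of $G$. A vertex $x$ is an articulation vertex of $G$ if $G-x$ has more connected components than $G$. A connected graph is biconnected if removing any single vertex $x$ leaves it connected (so $K_1$ and $K_2$ are biconnected). A block graph is a graph in which every maximal biconnected subgraph is a clique (complete graph). *)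

theory Defs
  imports "Graph_Theory.Digraph_Component" "Graph_Theory.Kuratowski"
begin

text \<open>
  A finite simple undirected graph is a symmetric digraph in the sense of the locale predicate
  \<^const>\<open>Digraph.graph\<close>: finite, loop-free, no parallel arcs, every arc paired with its reverse.
  That locale admits the null graph, but \<^const>\<open>Digraph_Component.connected\<close> does not.
\<close>

definition shortest_path ::
  "('a, 'b) pre_digraph \<Rightarrow> 'a \<Rightarrow> 'b awalk \<Rightarrow> 'a \<Rightarrow> bool" where
  "shortest_path G u p v \<longleftrightarrow>
     pre_digraph.apath G u p v \<and> (\<forall>q. pre_digraph.apath G u q v \<longrightarrow> length p \<le> length q)"

definition mutually_visible ::
  "('a, 'b) pre_digraph \<Rightarrow> 'a set \<Rightarrow> 'a \<Rightarrow> 'a \<Rightarrow> bool" where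
  "mutually_visible G P u v \<longleftrightarrow>
     (\<exists>p. shortest_path G u p v \<and> set (pre_digraph.awalk_verts G u p) \<inter> P \<subseteq> {u, v})"

definition mutual_visibility_set :: "('a, 'b) pre_digraph \<Rightarrow> 'a set \<Rightarrow> bool" where
  "mutual_visibility_set G P \<longleftrightarrow> P \<subseteq> verts G \<and> pairwise (mutually_visible G P) P"

text \<open>
  The maximum is over a nonempty set, since the empty set is a mutual-visibility set, and over
  a finite one whenever the vertex set is finite.
\<close>

definition mutual_visibility_number :: "('a, 'b) pre_digraph \<Rightarrow> nat" where
  "mutual_visibility_number G = Max {card P |P. mutual_visibility_set G P}"

text \<open>
  In a symmetric digraph the strongly connected components \<^const>\<open>pre_digraph.sccs\<close> are the
  connected components of the undirected graph.  The null graph has none, so the vertex of a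
  one-vertex graph is not an articulation vertex.
\<close>

definition articulation_vertex :: "('a, 'b) pre_digraph \<Rightarrow> 'a \<Rightarrow> bool" where
  "articulation_vertex G x \<longleftrightarrow>
     x \<in> verts G \<and>
     card (pre_digraph.sccs (pre_digraph.del_vert G x)) > card (pre_digraph.sccs G)"

text \<open>
  A subdigraph of a symmetric digraph need not be symmetric, so \<^const>\<open>Digraph.graph\<close> is part of
  the definition: the maximal biconnected subgraphs below then range over undirected subgraphs
  only.  The null graph left by deleting the vertex of a one-vertex graph is exempted because the
  one-vertex graph counts as biconnected.
\<close>

definition biconnected :: "('a, 'b) pre_digraph \<Rightarrow> bool" where
  "biconnected H \<longleftrightarrow>
     Digraph.graph H \<and> Digraph_Component.connected H \<and>
     (\<forall>x \<in> verts H. verts H \<noteq> {x} \<longrightarrow>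
        Digraph_Component.connected (pre_digraph.del_vert H x))"

definition block_graph :: "('a, 'b) pre_digraph \<Rightarrow> bool" where
  "block_graph G \<longleftrightarrow>
     Digraph.graph G \<and>
     (\<forall>H. pre_digraph.max_subgraph G biconnected H \<longrightarrow> complete_digraph (card (verts H)) H)"

end

theory Submission
  imports Defs
begin

text \<open>
  An interior vertex \<open>w\<close> of a shortest path has path neighbours \<open>a\<close>, \<open>b\<close> that are not adjacent.
  If \<open>w\<close> were not an articulation vertex, a path from \<open>a\<close> to \<open>b\<close> in \<open>G - w\<close> would close up to
  a cycle through \<open>a\<close>, \<open>w\<close>, \<open>b\<close>; it lies in a maximal biconnected subgraph, which is a clique.
  So shortest paths meet \<open>V - X\<close> only in their ends.

  For the bound, let \<open>P\<close> be a mutual-visibility set and \<open>x\<close> an articulation vertex in \<open>P\<close>.  The rest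
  of \<open>P\<close> lies in one component of \<open>G - x\<close>, so some component of \<open>G - x\<close> avoids \<open>P\<close>, and its
  vertex farthest from \<open>x\<close> is not an articulation vertex.  Components chosen for different \<open>x\<close>
  are disjoint, so trading each \<open>x\<close> for that vertex maps \<open>P\<close> injectively into \<open>V - X\<close>.
\<close>

section \<open>Walks and reachability in induced subgraphs\<close>

lemma (in wf_digraph) del_vert_eq_induce: "del_vert x = G \<restriction> (verts G - {x})"
  by (auto simp: del_vert_def induce_subgraph_def)

lemma (in wf_digraph) reachable_induceE:
  assumes "u \<rightarrow>\<^sup>*\<^bsub>G \<restriction> S\<^esub> v" "S \<subseteq> verts G"
  obtains p where "apath u p v" "set (awalk_verts u p) \<subseteq> S"
proof -
  interpret S: wf_digraph "G \<restriction> S" by (rule wellformed_induce_subgraph)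
  from assms(1) obtain p where p: "S.apath u p v"
    by (auto simp: S.reachable_apath)
  then have "apath u p v"
    using assms(2) by (auto intro: subgraph_apath_imp_apath subgraph_induce_subgraphI)
  moreover from p have "set (awalk_verts u p) \<subseteq> S"
    by (metis S.awalkE' S.awalkI_apath awalk_verts_induce induce_subgraph_verts)
  ultimately show ?thesis by (rule that)
qed

lemma (in wf_digraph) reachable_induceI:
  assumes "awalk u p v" "set (awalk_verts u p) \<subseteq> S"
  shows "u \<rightarrow>\<^sup>*\<^bsub>G \<restriction> S\<^esub> v"
proof -
  interpret S: wf_digraph "G \<restriction> S" by (rule wellformed_induce_subgraph)
  show ?thesis using assms by (metis S.reachable_awalkI awalk_induce)
qed

lemma (in sym_digraph) sym_digraph_induce: "S \<subseteq> verts G \<Longrightarrow> sym_digraph (G \<restriction> S)"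
  by (rule induced_graph_imp_graph) (rule induced_induce)

text \<open>A path repeats no arc, so its length is the size of its arc set, and extracting the path
  only discards arcs of the walk.\<close>

lemma (in wf_digraph) length_awalk_to_apath:
  assumes "awalk u p v"
  shows "length (awalk_to_apath p) \<le> length p"
proof -
  have "distinct (awalk_to_apath p)"
    using apath_awalk_to_apath[OF assms] unfolding apath_def
    by (blast intro: distinct_verts_imp_distinct)
  then have "length (awalk_to_apath p) = card (set (awalk_to_apath p))"
    by (simp add: distinct_card)
  also have "\<dots> \<le> card (set p)"
    using awalk_to_apath_subset[OF assms] by (simp add: card_mono)
  also have "\<dots> \<le> length p" by (rule card_length)
  finally show ?thesis .
qed

text \<open>\<open>shortest_path\<close> compares with paths only. Extending the comparison to walks
  means that a shortcut need not be shown to be a path.\<close>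

lemma (in wf_digraph) shortest_path_le_awalk:
  assumes "shortest_path G u p v" "awalk u q v"
  shows "length p \<le> length q"
  using assms apath_awalk_to_apath[OF assms(2)] length_awalk_to_apath[OF assms(2)]
  unfolding shortest_path_def by (meson le_trans)

lemma (in wf_digraph) shortest_path_exists:
  assumes "u \<rightarrow>\<^sup>* v"
  obtains p where "shortest_path G u p v"
proof -
  from assms obtain q where "apath u q v" by (auto simp: reachable_apath)
  from ex_has_least_nat[of "\<lambda>q. apath u q v", OF this, of length] that show ?thesis
    unfolding shortest_path_def by blast
qed

text \<open>The intersection property is the one that later arguments live on: a vertex other than
  \<open>w\<close> can lie on only one of the two halves.\<close>

lemma (in wf_digraph) apath_splitE:
  assumes "apath u p v" "w \<in> set (awalk_verts u p)"
  obtains q r where "p = q @ r" "apath u q w" "apath w r v"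
    "set (awalk_verts u q) \<inter> set (awalk_verts w r) = {w}"
    "set (awalk_verts u p) = set (awalk_verts u q) \<union> set (awalk_verts w r)"
proof -
  from assms obtain q r where p: "p = q @ r" and q: "awalk u q w" and r: "awalk w r v"
    using awalk_decomp awalkI_apath by blast
  then have w: "awlast u q = w" by auto
  with assms(1) have *: "apath u q w" "apath w r v"
    "set (awalk_verts u q) \<inter> set (tl (awalk_verts w r)) = {}"
    unfolding p apath_append_iff by auto
  have "awalk_verts w r = w # tl (awalk_verts w r)"
    by (metis awalkE' awalk_verts_non_Nil list.collapse r)
  moreover have "w \<in> set (awalk_verts u q)"
    using w by (metis awalk_verts_non_Nil last_in_set)
  ultimately have "set (awalk_verts u q) \<inter> set (awalk_verts w r) = {w}"
    using *(3) by (metis Int_insert_right_if1 list.simps(15))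
  with p * that show ?thesis using set_awalk_verts_append[OF q r] by blast
qed

section \<open>Articulation vertices\<close>

lemma (in fin_digraph) card_sccs_gt_1_iff:
  assumes "symmetric G"
  shows "1 < card sccs \<longleftrightarrow> (\<exists>u\<in>verts G. \<exists>v\<in>verts G. \<not> u \<rightarrow>\<^sup>* v)"
proof
  assume *: "1 < card sccs"
  show "\<exists>u\<in>verts G. \<exists>v\<in>verts G. \<not> u \<rightarrow>\<^sup>* v"
  proof (rule ccontr)
    assume "\<not> ?thesis"
    \<comment> \<open>\<open>strongly_connected\<close> excludes the null graph, which has no
      component; in the other case there is exactly one.\<close>
    then have "verts G = {} \<or> strongly_connected G" by auto
    moreover have "verts G = {} \<Longrightarrow> card sccs = 0"
      using card_sccs_verts sccs_verts_conv_scc_of by (metis card.empty image_empty)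
    ultimately show False using * by (auto simp: strongly_connected_eq_iff)
  qed
next
  assume "\<exists>u\<in>verts G. \<exists>v\<in>verts G. \<not> u \<rightarrow>\<^sup>* v"
  then obtain u v where uv: "u \<in> verts G" "v \<in> verts G" "\<not> u \<rightarrow>\<^sup>* v" by blast
  then have "scc_of u \<noteq> scc_of v"
    using in_scc_of_self[of v] by (auto simp: scc_of_def)
  moreover have "{scc_of u, scc_of v} \<subseteq> sccs_verts"
    using uv by (auto intro: scc_of_in_sccs_verts)
  then have "card {scc_of u, scc_of v} \<le> card sccs_verts"
    by (rule card_mono[OF finite_sccs_verts])
  ultimately show "1 < card sccs" by (simp add: card_sccs_verts)
qed

text \<open>A strongly connected graph has exactly one component, so comparing the two counts
  amounts to asking whether \<open>G - x\<close> has more than one.\<close>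

lemma (in graph) articulation_vertex_iff:
  assumes "strongly_connected G"
  shows "articulation_vertex G x \<longleftrightarrow> x \<in> verts G \<and>
    (\<exists>u\<in>verts G - {x}. \<exists>v\<in>verts G - {x}. \<not> u \<rightarrow>\<^sup>*\<^bsub>G \<restriction> (verts G - {x})\<^esub> v)"
proof -
  have "card sccs = 1" using assms by (simp add: strongly_connected_eq_iff)
  moreover interpret D: fin_digraph "G \<restriction> (verts G - {x})"
    using fin_digraph_del_vert[of x] by (simp add: del_vert_eq_induce)
  have "symmetric (G \<restriction> (verts G - {x}))"
    using sym_digraph_induce[of "verts G - {x}"] by (simp add: sym_digraph.sym_arcs)
  note D.card_sccs_gt_1_iff[OF this]
  ultimately show ?thesis
    unfolding articulation_vertex_def by (simp add: del_vert_eq_induce)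
qed

section \<open>Interior vertices of shortest paths in block graphs\<close>

text \<open>Among the subgraphs with \<open>Q\<close> that contain \<open>H\<close>, one with the
  most vertices and arcs together is maximal: a subgraph with \<open>Q\<close> above it has the same
  counts, hence the same vertices and arcs.\<close>

lemma (in fin_digraph) max_subgraph_extends:
  assumes "subgraph H G" "Q H"
  obtains M where "max_subgraph Q M" "subgraph H M"
proof -
  let ?C = "\<lambda>K. subgraph H K \<and> subgraph K G \<and> Q K"
  let ?m = "\<lambda>K. card (verts K) + card (arcs K)"
  interpret H: wf_digraph H using assms(1) by auto
  have "?C H" using assms H.subgraph_refl by auto
  moreover have "\<forall>K. ?C K \<longrightarrow> ?m K < Suc (?m G)"
    by (auto simp: less_Suc_eq_le intro!: add_mono card_mono)
  ultimately obtain M where M: "?C M" and max: "\<And>K. ?C K \<Longrightarrow> ?m K \<le> ?m M"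
    using ex_has_greatest_nat[of ?C H ?m] by blast
  have "K = M" if K: "subgraph M K" "subgraph K G" "Q K" for K
  proof -
    interpret K: fin_digraph K using K(2) by (rule fin_digraph_subgraph)
    have sub: "verts M \<subseteq> verts K" "arcs M \<subseteq> arcs K" using K(1) by auto
    then have "card (verts M) \<le> card (verts K)" "card (arcs M) \<le> card (arcs K)"
      by (auto intro: card_mono)
    moreover have "?m K \<le> ?m M" using max[of K] K M subgraph_trans by blast
    ultimately have "card (verts M) = card (verts K)" "card (arcs M) = card (arcs K)" by linarith+
    with sub have "verts M = verts K" "arcs M = arcs K"
      by (simp_all add: card_subset_eq)
    with K(1) show ?thesis by (auto simp: subgraph_def compatible_def)
  qed
  with M that[of M] show ?thesis unfolding max_subgraph_def by blast
qed

text \<open>The path and \<open>w\<close> form a closed circuit. Deleting \<open>w\<close> leaves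
  the path; after deleting any other vertex, each remaining vertex still reaches \<open>w\<close>
  around one side of the circuit.\<close>

lemma (in graph) biconnected_cycle:
  assumes p: "apath a p b" and w: "w \<notin> set (awalk_verts a p)"
    and aw: "a \<rightarrow> w" and bw: "b \<rightarrow> w"
  shows "biconnected (G \<restriction> insert w (set (awalk_verts a p)))" (is "biconnected (G \<restriction> ?S)")
proof -
  have pV: "set (awalk_verts a p) \<subseteq> verts G" using p awalkI_apath by blast
  then have S: "?S \<subseteq> verts G" using aw adj_in_verts by blast
  \<comment> \<open>By symmetry it is enough that all vertices reach one hub \<open>h\<close>. The
    hub is \<open>b\<close> once \<open>w\<close> is deleted, and \<open>w\<close>
    otherwise.\<close>
  have conn: "Digraph_Component.connected (G \<restriction> T)"
    if T: "T \<subseteq> verts G" "h \<in> T" "\<And>y. y \<in> T \<Longrightarrow> y \<rightarrow>\<^sup>*\<^bsub>G \<restriction> T\<^esub> h" for T h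
  proof -
    interpret T: sym_digraph "G \<restriction> T" using T(1) by (rule sym_digraph_induce)
    show ?thesis
    proof (rule T.connectedI)
      fix y z assume "y \<in> verts (G \<restriction> T)" "z \<in> verts (G \<restriction> T)"
      then have "y \<rightarrow>\<^sup>*\<^bsub>G \<restriction> T\<^esub> z"
        using T by (metis T.reachable_trans T.symmetric_reachable' induce_subgraph_verts)
      then show "y \<rightarrow>\<^sup>*\<^bsub>mk_symmetric (G \<restriction> T)\<^esub> z" by (rule T.reachable_mk_symmetricI)
    qed (use T in auto)
  qed
  have arcT: "y \<rightarrow>\<^bsub>G \<restriction> T\<^esub> z" if "y \<rightarrow> z" "y \<in> T" "z \<in> T" for y z T
    using that by (auto simp: arcs_ends_conv)
  have to_b: "y \<rightarrow>\<^sup>*\<^bsub>G \<restriction> T\<^esub> w"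
    if "awalk y r b" "set (awalk_verts y r) \<subseteq> T" "w \<in> T" for y r T
  proof -
    interpret T: wf_digraph "G \<restriction> T" ..
    have "b \<in> T" using that by (metis awalkE' awalk_verts_non_Nil last_in_set subsetD)
    then have "b \<rightarrow>\<^bsub>G \<restriction> T\<^esub> w" using that bw arcT by blast
    with reachable_induceI[OF that(1,2)] show ?thesis by (rule T.reachable_adj_trans)
  qed
  have to_a: "y \<rightarrow>\<^sup>*\<^bsub>G \<restriction> T\<^esub> w"
    if "awalk a q y" "set (awalk_verts a q) \<subseteq> T" "w \<in> T" "T \<subseteq> verts G" for y q T
  proof -
    interpret T: sym_digraph "G \<restriction> T" using that(4) by (rule sym_digraph_induce)
    have "a \<in> T" using that hd_in_awalk_verts by blast
    then have "a \<rightarrow>\<^bsub>G \<restriction> T\<^esub> w" using that aw arcT by blast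
    moreover have "y \<rightarrow>\<^sup>*\<^bsub>G \<restriction> T\<^esub> a"
      using reachable_induceI[OF that(1,2)] by (rule T.symmetric_reachable')
    ultimately show ?thesis by (rule T.reachable_adj_trans[rotated])
  qed
  have del: "Digraph_Component.connected (G \<restriction> (?S - {x}))" for x
  proof (cases "x = w")
    case True
    have "y \<rightarrow>\<^sup>*\<^bsub>G \<restriction> (?S - {x})\<^esub> b" if "y \<in> ?S - {x}" for y
    proof -
      have "y \<in> set (awalk_verts a p)" using that True by auto
      with p obtain q r where "apath y r b"
        "set (awalk_verts a p) = set (awalk_verts a q) \<union> set (awalk_verts y r)"
        using apath_splitE by metis
      then show ?thesis
        using w True by (intro reachable_induceI[OF awalkI_apath]) auto
    qed
    moreover have "b \<in> set (awalk_verts a p)"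
      using p by (metis awalkE' awalkI_apath awalk_verts_non_Nil last_in_set)
    ultimately show ?thesis using S w True by (intro conn[of _ b]) auto
  next
    case False
    have "y \<rightarrow>\<^sup>*\<^bsub>G \<restriction> (?S - {x})\<^esub> w" if y: "y \<in> ?S - {x}" for y
    proof (cases "y = w")
      case True
      interpret T: wf_digraph "G \<restriction> (?S - {x})" ..
      show ?thesis using True y by (auto intro: T.reachable_refl)
    next
      case nw: False
      then have "y \<in> set (awalk_verts a p)" using y by auto
      with p obtain q r where qr: "apath a q y" "apath y r b"
        "set (awalk_verts a q) \<inter> set (awalk_verts y r) = {y}"
        "set (awalk_verts a p) = set (awalk_verts a q) \<union> set (awalk_verts y r)"
        by (rule apath_splitE)
      \<comment> \<open>The halves share only \<open>y\<close>, and \<open>x\<close> differs from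
        \<open>y\<close>, so at least one half survives the deletion.\<close>
      then have "x \<notin> set (awalk_verts a q) \<or> x \<notin> set (awalk_verts y r)" using y by auto
      then show ?thesis
      proof
        assume "x \<notin> set (awalk_verts a q)"
        with qr S False show ?thesis by (intro to_a[OF awalkI_apath]) auto
      next
        assume "x \<notin> set (awalk_verts y r)"
        with qr False show ?thesis by (intro to_b[OF awalkI_apath]) auto
      qed
    qed
    then show ?thesis using S False by (intro conn[of _ w]) auto
  qed
  interpret H: wf_digraph "G \<restriction> ?S" ..
  have sub: "induced_subgraph (G \<restriction> ?S) G" using S by (rule induced_induce)
  have "y \<rightarrow>\<^sup>*\<^bsub>G \<restriction> ?S\<^esub> w" if y: "y \<in> ?S" for y
  proof (cases "y = w")
    case True
    then show ?thesis by (simp add: H.reachable_refl)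
  next
    case False
    then have "y \<in> set (awalk_verts a p)" using y by auto
    with p obtain q r where "apath y r b"
      "set (awalk_verts a p) = set (awalk_verts a q) \<union> set (awalk_verts y r)"
      by (rule apath_splitE)
    then show ?thesis by (intro to_b[OF awalkI_apath]) auto
  qed
  then have "Digraph_Component.connected (G \<restriction> ?S)"
    using S by (intro conn[of _ w]) auto
  moreover have "graph (G \<restriction> ?S)"
    using digraphI_induced[OF sub] induced_graph_imp_symmetric[OF sym_arcs sub]
    by (rule digraph.graphI)
  moreover have "pre_digraph.del_vert (G \<restriction> ?S) x = G \<restriction> (?S - {x})" for x
    by (auto simp: pre_digraph.del_vert_def induce_subgraph_def)
  ultimately show ?thesis unfolding biconnected_def by (simp add: del)
qed

text \<open>Read contrapositively: in a block graph, \<open>w\<close> separates any two of its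
  distinct non-adjacent neighbours.\<close>

lemma (in graph) block_graph_no_detour:
  assumes bg: "block_graph G" and ab: "a \<noteq> b" "a \<rightarrow> w" "w \<rightarrow> b"
    and r: "a \<rightarrow>\<^sup>*\<^bsub>G \<restriction> (verts G - {w})\<^esub> b"
  shows "a \<rightarrow> b"
proof -
  from r obtain p where p: "apath a p b" "set (awalk_verts a p) \<subseteq> verts G - {w}"
    by (rule reachable_induceE) auto
  define S where "S = insert w (set (awalk_verts a p))"
  have "biconnected (G \<restriction> S)" unfolding S_def
    using p ab by (intro biconnected_cycle[of a p b]) (auto intro: graph_symmetric)
  moreover have "subgraph (G \<restriction> S) G"
    using p ab adj_in_verts by (intro subgraph_induce_subgraphI) (auto simp: S_def)
  ultimately obtain M where M: "max_subgraph biconnected M" "subgraph (G \<restriction> S) M"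
    using max_subgraph_extends by metis
  then have "complete_digraph (card (verts M)) M" using bg by (auto simp: block_graph_def)
  moreover have "a \<in> S" "b \<in> S"
    using p(1) unfolding S_def
    by (metis awalkE' awalkI_apath awalk_verts_non_Nil last_in_set hd_in_set insertCI)+
  then have "a \<in> verts M" "b \<in> verts M"
    using subgraph_imp_subverts[OF M(2)] by auto
  ultimately have "a \<rightarrow>\<^bsub>M\<^esub> b" using ab(1) by (auto simp: complete_digraph_def)
  then show ?thesis using M(1) subgraphI_max_subgraph adj_mono by blast
qed

lemma (in graph) shortest_path_interior_articulation:
  assumes bg: "block_graph G" and sc: "strongly_connected G"
    and p: "shortest_path G u p v" and w: "w \<in> set (awalk_verts u p)" "w \<noteq> u" "w \<noteq> v"
  shows "articulation_vertex G w"
proof (rule ccontr)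
  assume na: "\<not> articulation_vertex G w"
  have ap: "apath u p v" using p by (simp add: shortest_path_def)
  from apath_splitE[OF ap w(1)] obtain q r where qr: "p = q @ r" "apath u q w" "apath w r v"
    "set (awalk_verts u q) \<inter> set (awalk_verts w r) = {w}" by metis
  have "q \<noteq> []" "r \<noteq> []" using qr w by (auto simp: apath_Nil_iff)
  then obtain q' e f r' where ef: "q = q' @ [e]" "r = f # r'"
    by (metis neq_Nil_conv rev_exhaust)
  have wv: "w \<in> verts G" using awalk_last_in_verts awalkI_apath qr by blast
  define a b where "a = tail G e" and "b = head G f"
  have 1: "awalk u q' a" "e \<in> arcs G" "head G e = w" and 2: "awalk b r' v" "f \<in> arcs G" "tail G f = w"
    using qr(2,3)[THEN awalkI_apath] unfolding ef
    by (auto simp: awalk_simps a_def b_def)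
  have adj: "a \<rightarrow> w" "w \<rightarrow> b"
    using 1 2 in_arcs_imp_in_arcs_ends unfolding a_def b_def by metis+
  \<comment> \<open>The two path neighbours of \<open>w\<close> lie on different halves, which share
    only \<open>w\<close>; hence they are distinct.\<close>
  have "a \<in> set (awalk_verts u q)" unfolding ef a_def by (simp add: awalk_verts_arc1)
  moreover have "b \<in> set (awalk_verts w r)"
    using hd_in_awalk_verts(1)[OF 2(1)] by (simp add: ef b_def)
  moreover have neq: "a \<noteq> w" "b \<noteq> w" using adj adj_not_same by auto
  ultimately have "a \<noteq> b" using qr(4) by blast
  moreover have "a \<rightarrow>\<^sup>*\<^bsub>G \<restriction> (verts G - {w})\<^esub> b"
    using na wv neq adj adj_in_verts unfolding articulation_vertex_iff[OF sc] by blast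
  ultimately have "a \<rightarrow> b" using block_graph_no_detour bg adj by blast
  \<comment> \<open>Replacing the two arcs \<open>e\<close>, \<open>f\<close> through
    \<open>w\<close> by the single arc \<open>g\<close> gives a walk one arc shorter than
    \<open>p\<close>.\<close>
  then obtain g where "g \<in> arcs G" "tail G g = a" "head G g = b" by auto
  then have "awalk u (q' @ g # r') v"
    using 1 2 by (auto intro: awalk_appendI simp: awalk_simps)
  from shortest_path_le_awalk[OF p this] show False by (simp add: qr ef)
qed

section \<open>The upper bound\<close>

text \<open>Take \<open>z\<close> in the component of \<open>w\<close> in \<open>G - x\<close> at
  greatest distance from \<open>x\<close>. A shortest path to \<open>x\<close> from another vertex
  cannot pass through \<open>z\<close>, since its start would lie in the same component and farther
  away. So all other vertices still reach \<open>x\<close> without \<open>z\<close>.\<close>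

lemma (in graph) non_articulation_in_component:
  assumes sc: "strongly_connected G" and x: "x \<in> verts G" and w: "w \<in> verts G - {x}"
  obtains z where "w \<rightarrow>\<^sup>*\<^bsub>G \<restriction> (verts G - {x})\<^esub> z" "\<not> articulation_vertex G z"
proof -
  let ?D = "G \<restriction> (verts G - {x})"
  interpret D: sym_digraph ?D by (rule sym_digraph_induce) auto
  \<comment> \<open>Pairing a vertex with a shortest path to \<open>x\<close> lets path length stand
    for distance in the maximization.\<close>
  let ?C = "\<lambda>zp. w \<rightarrow>\<^sup>*\<^bsub>?D\<^esub> fst zp \<and> shortest_path G (fst zp) (snd zp) x"
  have ex: "\<exists>p. shortest_path G y p x" if "y \<in> verts G" for y
    using sc that x by (metis strongly_connected_def shortest_path_exists)
  then obtain p0 where "shortest_path G w p0 x" using w by blast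
  moreover have "w \<rightarrow>\<^sup>*\<^bsub>?D\<^esub> w" using w by simp
  ultimately have "?C (w, p0)" by simp
  moreover have "\<forall>zp. ?C zp \<longrightarrow> length (snd zp) < card (verts G)"
    by (auto simp: shortest_path_def dest: length_apath_less)
  ultimately obtain zp where zp: "?C zp"
    and "\<forall>zp'. ?C zp' \<longrightarrow> length (snd zp') \<le> length (snd zp)"
    using ex_has_greatest_nat[of ?C "(w, p0)" "\<lambda>zp. length (snd zp)"] by blast
  then have max: "length p' \<le> length (snd zp)"
    if "w \<rightarrow>\<^sup>*\<^bsub>?D\<^esub> z'" "shortest_path G z' p' x" for z' p'
    using that by (metis fst_conv snd_conv)
  define z p where "z = fst zp" and "p = snd zp"
  have z: "w \<rightarrow>\<^sup>*\<^bsub>?D\<^esub> z" "shortest_path G z p x" using zp by (simp_all add: z_def p_def)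
  note max = max[folded p_def]
  have zx: "z \<noteq> x" using D.reachable_in_verts[OF z(1)] by auto
  let ?Z = "G \<restriction> (verts G - {z})"
  interpret Z: sym_digraph ?Z by (rule sym_digraph_induce) auto
  have to_x: "y \<rightarrow>\<^sup>*\<^bsub>?Z\<^esub> x" if y: "y \<in> verts G - {z}" for y
  proof -
    obtain q where q: "shortest_path G y q x" using ex y by blast
    then have aq: "apath y q x" by (simp add: shortest_path_def)
    have "z \<notin> set (awalk_verts y q)"
    proof
      assume "z \<in> set (awalk_verts y q)"
      with aq obtain s t where st: "q = s @ t" "apath y s z" "apath z t x"
        "set (awalk_verts y s) \<inter> set (awalk_verts z t) = {z}" by (rule apath_splitE)
      \<comment> \<open>As the end of \<open>t\<close>, \<open>x\<close> is not on \<open>s\<close>,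
        so \<open>s\<close> joins \<open>y\<close> to \<open>z\<close> inside \<open>G - x\<close>
        and the maximality of \<open>p\<close> applies to \<open>y\<close>.\<close>
      have "x \<in> set (awalk_verts z t)"
        using st(3) by (metis awalkE' awalkI_apath awalk_verts_non_Nil last_in_set)
      with st zx have "x \<notin> set (awalk_verts y s)" by auto
      moreover have "set (awalk_verts y s) \<subseteq> verts G" using st awalkI_apath by blast
      ultimately have "y \<rightarrow>\<^sup>*\<^bsub>?D\<^esub> z"
        using st by (intro reachable_induceI[OF awalkI_apath]) auto
      then have "w \<rightarrow>\<^sup>*\<^bsub>?D\<^esub> y" using z D.symmetric_reachable' D.reachable_trans by blast
      \<comment> \<open>With \<open>p\<close> no longer than \<open>t\<close>, the first half
        \<open>s\<close> of \<open>q\<close> must be empty, which forces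
        \<open>y = z\<close>.\<close>
      then have "length q \<le> length p" using max q by blast
      also have "\<dots> \<le> length t" using z(2) st by (auto simp: shortest_path_def)
      finally have "s = []" using st by simp
      with st y show False by (auto simp: apath_Nil_iff)
    qed
    moreover have "set (awalk_verts y q) \<subseteq> verts G" using aq awalkI_apath by blast
    ultimately show ?thesis using aq by (intro reachable_induceI[OF awalkI_apath]) auto
  qed
  have "\<not> articulation_vertex G z"
    using to_x Z.symmetric_reachable' Z.reachable_trans
    unfolding articulation_vertex_iff[OF sc] by blast
  with z that show ?thesis by blast
qed

text \<open>A path witnessing visibility meets \<open>P\<close> only in its ends, so it survives the
  deletion of any other member \<open>x\<close> of \<open>P\<close>.\<close>

lemma (in graph) visible_avoids:
  assumes "mutual_visibility_set G P" "x \<in> P" "y \<in> P - {x}" "z \<in> P - {x}"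
  shows "y \<rightarrow>\<^sup>*\<^bsub>G \<restriction> (verts G - {x})\<^esub> z"
proof (cases "y = z")
  case True
  interpret D: wf_digraph "G \<restriction> (verts G - {x})" ..
  show ?thesis using assms True
    by (auto simp: mutual_visibility_set_def intro!: D.reachable_refl)
next
  case False
  with assms have "mutually_visible G P y z"
    by (auto simp: mutual_visibility_set_def pairwise_def)
  then obtain p where p: "apath y p z" "set (awalk_verts y p) \<inter> P \<subseteq> {y, z}"
    by (auto simp: mutually_visible_def shortest_path_def)
  moreover have "set (awalk_verts y p) \<subseteq> verts G" using p awalkI_apath by blast
  ultimately show ?thesis
    using assms by (intro reachable_induceI[OF awalkI_apath]) auto
qed

text \<open>Vertices \<open>u\<close> and \<open>v\<close> separated by \<open>x\<close> cannot both
  have components meeting \<open>P - {x}\<close>, since \<open>P - {x}\<close> lies within one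
  component. The last conclusion, that \<open>z\<close> is cut off from \<open>P - {x}\<close>, is
  what makes the choice injective.\<close>

lemma (in graph) private_non_articulation:
  assumes sc: "strongly_connected G" and P: "mutual_visibility_set G P"
    and x: "x \<in> P" "articulation_vertex G x"
  obtains z where "z \<in> verts G - P" "\<not> articulation_vertex G z"
    "\<And>y. y \<in> P - {x} \<Longrightarrow> \<not> z \<rightarrow>\<^sup>*\<^bsub>G \<restriction> (verts G - {x})\<^esub> y"
proof -
  let ?D = "G \<restriction> (verts G - {x})"
  interpret D: sym_digraph ?D by (rule sym_digraph_induce) auto
  from x obtain u v where uv: "u \<in> verts G - {x}" "v \<in> verts G - {x}" "\<not> u \<rightarrow>\<^sup>*\<^bsub>?D\<^esub> v"
    and xV: "x \<in> verts G"
    unfolding articulation_vertex_iff[OF sc] by blast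
  have "\<exists>w\<in>{u, v}. \<forall>y\<in>P - {x}. \<not> w \<rightarrow>\<^sup>*\<^bsub>?D\<^esub> y"
  proof (rule ccontr)
    assume "\<not> ?thesis"
    then obtain y y' where y: "y \<in> P - {x}" "u \<rightarrow>\<^sup>*\<^bsub>?D\<^esub> y" "y' \<in> P - {x}" "v \<rightarrow>\<^sup>*\<^bsub>?D\<^esub> y'" by auto
    have "y \<rightarrow>\<^sup>*\<^bsub>?D\<^esub> y'" using visible_avoids[OF P x(1)] y by blast
    with y have "u \<rightarrow>\<^sup>*\<^bsub>?D\<^esub> v" using D.symmetric_reachable' D.reachable_trans by meson
    with uv show False by blast
  qed
  then obtain w where w: "w \<in> verts G - {x}" "\<And>y. y \<in> P - {x} \<Longrightarrow> \<not> w \<rightarrow>\<^sup>*\<^bsub>?D\<^esub> y"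
    using uv by blast
  obtain z where z: "w \<rightarrow>\<^sup>*\<^bsub>?D\<^esub> z" "\<not> articulation_vertex G z"
    using non_articulation_in_component[OF sc xV w(1)] by blast
  then have zD: "z \<in> verts G - {x}" using D.reachable_in_verts[OF z(1)] by auto
  \<comment> \<open>Otherwise \<open>z\<close> itself would be a member of \<open>P - {x}\<close>
    reached from \<open>w\<close>.\<close>
  then have "z \<notin> P" using w(2)[of z] z(1) by blast
  moreover have "\<not> z \<rightarrow>\<^sup>*\<^bsub>?D\<^esub> y" if "y \<in> P - {x}" for y
    using w(2)[OF that] z(1) D.reachable_trans by blast
  ultimately show ?thesis using that z(2) zD by blast
qed

text \<open>On a path from \<open>z\<close>, whichever of \<open>x\<close> and \<open>y\<close> comes first is reached while avoiding the other.\<close>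

lemma (in wf_digraph) reaches_one_avoiding_other:
  assumes "z \<rightarrow>\<^sup>* x" "x \<noteq> y"
  shows "z \<rightarrow>\<^sup>*\<^bsub>G \<restriction> (verts G - {y})\<^esub> x \<or> z \<rightarrow>\<^sup>*\<^bsub>G \<restriction> (verts G - {x})\<^esub> y"
proof -
  from assms obtain p where p: "apath z p x" by (auto simp: reachable_apath)
  then have pV: "set (awalk_verts z p) \<subseteq> verts G" using awalkI_apath by blast
  show ?thesis
  proof (cases "y \<in> set (awalk_verts z p)")
    case False
    with p pV show ?thesis by (intro disjI1 reachable_induceI[OF awalkI_apath]) auto
  next
    case True
    with p obtain q r where qr: "apath z q y" "apath y r x"
      "set (awalk_verts z q) \<inter> set (awalk_verts y r) = {y}"
      "set (awalk_verts z p) = set (awalk_verts z q) \<union> set (awalk_verts y r)"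
      by (rule apath_splitE)
    have "x \<in> set (awalk_verts y r)"
      using qr(2) by (metis awalkE' awalkI_apath awalk_verts_non_Nil last_in_set)
    with qr assms have "x \<notin> set (awalk_verts z q)" by auto
    with qr pV show ?thesis by (intro disjI2 reachable_induceI[OF awalkI_apath]) auto
  qed
qed

text \<open>Members of \<open>P\<close> outside \<open>?X\<close> stay fixed. Those in
  \<open>?X\<close> are sent by \<open>f\<close> to non-articulation vertices outside
  \<open>P\<close>, so the two images cannot overlap.\<close>

lemma (in graph) card_mutual_visibility_set_le:
  assumes sc: "strongly_connected G" and P: "mutual_visibility_set G P"
  shows "card P \<le> card (verts G - {x. articulation_vertex G x})"
proof -
  let ?X = "{x. articulation_vertex G x}"
  have PV: "P \<subseteq> verts G" using P by (simp add: mutual_visibility_set_def)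
  have "\<forall>x\<in>P \<inter> ?X. \<exists>z. z \<in> verts G - P \<and> \<not> articulation_vertex G z \<and>
    (\<forall>y\<in>P - {x}. \<not> z \<rightarrow>\<^sup>*\<^bsub>G \<restriction> (verts G - {x})\<^esub> y)"
    using private_non_articulation[OF sc P] by (metis IntE mem_Collect_eq)
  then obtain f where f: "\<And>x. x \<in> P \<inter> ?X \<Longrightarrow> f x \<in> verts G - P \<and> \<not> articulation_vertex G (f x) \<and>
    (\<forall>y\<in>P - {x}. \<not> f x \<rightarrow>\<^sup>*\<^bsub>G \<restriction> (verts G - {x})\<^esub> y)"
    by (metis (no_types, lifting))
  have "inj_on f (P \<inter> ?X)"
  proof (rule inj_onI, rule ccontr)
    fix x y assume xy: "x \<in> P \<inter> ?X" "y \<in> P \<inter> ?X" "f x = f y" "x \<noteq> y"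
    \<comment> \<open>The common value reaches \<open>x\<close> avoiding \<open>y\<close>, against
      the choice of \<open>f y\<close>, or \<open>y\<close> avoiding \<open>x\<close>, against that
      of \<open>f x\<close>.\<close>
    have "f x \<rightarrow>\<^sup>* x" using sc xy f[of x] PV by (auto simp: strongly_connected_def)
    from reaches_one_avoiding_other[OF this xy(4)] show False
      using f[OF xy(1)] f[OF xy(2)] xy by auto
  qed
  moreover have "f ` (P \<inter> ?X) \<subseteq> (verts G - ?X) - P" using f by auto
  ultimately have "card (P \<inter> ?X) \<le> card ((verts G - ?X) - P)"
    by (simp add: card_inj_on_le)
  moreover have "card P = card (P \<inter> ?X) + card (P - ?X)"
    using PV finite_subset[OF PV] by (simp add: card_Int_Diff)
  moreover have "card (verts G - ?X) = card ((verts G - ?X) - P) + card (P - ?X)"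
  proof -
    have "(verts G - ?X) \<inter> P = P - ?X" using PV by auto
    then show ?thesis using card_Int_Diff[of "verts G - ?X" P] by simp
  qed
  ultimately show ?thesis by simp
qed

theorem theorem4p2:
  fixes G :: "('a, 'b) pre_digraph" and X :: "'a set"
  assumes "Digraph.graph G"
    and "Digraph_Component.connected G"
    and "block_graph G"
    and "X = {x. articulation_vertex G x}"
  shows "mutual_visibility_set G (verts G - X) \<and>
         mutual_visibility_number G = card (verts G - X)"
proof -
  interpret graph G by fact
  have sc: "strongly_connected G"
    using assms(2) sym_arcs symmetric_connected_imp_strongly_connected by blast
  \<comment> \<open>Any shortest path serves as a witness, because its interior lies in
    \<open>X\<close>.\<close>
  have "mutually_visible G (verts G - X) u v" if "u \<in> verts G" "v \<in> verts G" for u v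
  proof -
    have "u \<rightarrow>\<^sup>*\<^bsub>G\<^esub> v" using sc that by (auto simp: strongly_connected_def)
    then obtain p where "shortest_path G u p v" by (rule shortest_path_exists)
    then show ?thesis
      using shortest_path_interior_articulation[OF assms(3) sc] assms(4)
      unfolding mutually_visible_def by blast
  qed
  then have vis: "mutual_visibility_set G (verts G - X)"
    by (auto simp: mutual_visibility_set_def pairwise_def)
  have le: "card P \<le> card (verts G - X)" if "mutual_visibility_set G P" for P
    using card_mutual_visibility_set_le[OF sc that] assms(4) by simp
  \<comment> \<open>The bound also supplies the finiteness needed to evaluate
    \<open>Max\<close>.\<close>
  then have "{card P |P. mutual_visibility_set G P} \<subseteq> {..card (verts G - X)}" by blast
  then have "finite {card P |P. mutual_visibility_set G P}"
    using finite_atMost by (rule finite_subset)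
  with vis le show ?thesis
    unfolding mutual_visibility_number_def by (auto intro!: Max_eqI)
qed

end
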